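(* Let $f\colon[0,1]\to[0,1]$. The following are equivalent (with respect to the standard binary representation): (1) $f$ is continuous and regular; (2) $f$ can be computed by a nondeterministic finite-state transducer (with some fixed delay) for the standard binary representation.
   Context: Standard binary representation: $\alpha\in\{0,1\}^\omega$ represents $\overline{\alpha}=\sum_{s}\alpha(s)2^{-s-1}\in[0,1]$ (dyadic rationals have two representations, both allowed). A function $f\colon[0,1]\to[0,1]$ is regular (to base 2) if there is a nondeterministic Büchi automaton $A$ over the alphabet $\{0,1\}$ such that for all $\alpha,\beta\in\{0,1\}^\omega$, $A$ accepts the interleaved word $\alpha(0)\beta(0)\alpha(1)\beta(1)\cdots$ (i.e. some run visits an accepting state infinitely often) if and only if $f(\overline{\alpha})=\overline{\beta}$. A nondeterministic finite-state transducer with delay $D$ has finitely many states, an initial state, and a transition relation; it reads the input one symbol at a time; while reading the first $D$ input symbols it writes nothing (but may change state), and thereafter on reading each input symbol it changes state and writes exactly one output symbol; a run may die (have no available transition). It computes $f$ with respect to a representation if for every $x\in[0,1]$ and every representation $\alpha$ of $x$: there is at least one infinite run on input $\alpha$, and every infinite run on input $\alpha$ writes a representation of $f(x)$. Here input and output alphabets are $\{0,1\}$ and the representation is the standard binary one. *)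

theory Defs
  imports Complex_Main "HOL-Library.FuncSet"
begin

text \<open>The letters 0 and 1 are the Booleans \<open>False\<close> and \<open>True\<close>; infinite words over
  \<open>{0,1}\<close> are functions \<open>nat \<Rightarrow> bool\<close>.\<close>

definition binary_value :: "(nat \<Rightarrow> bool) \<Rightarrow> real" where
  "binary_value \<alpha> = (\<Sum>s. of_bool (\<alpha> s) * (1/2) ^ (s + 1))"

definition represents :: "(nat \<Rightarrow> bool) \<Rightarrow> real \<Rightarrow> bool" where
  "represents \<alpha> x \<longleftrightarrow> binary_value \<alpha> = x"

definition interleave :: "(nat \<Rightarrow> 'a) \<Rightarrow> (nat \<Rightarrow> 'a) \<Rightarrow> nat \<Rightarrow> 'a" where
  "interleave \<alpha> \<beta> n = (if even n then \<alpha> (n div 2) else \<beta> (n div 2))"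

record ('q, 'a) nba =
  nba_states :: "'q set"
  nba_initial :: 'q
  nba_trans :: "('q \<times> 'a \<times> 'q) set"
  nba_accepting :: "'q set"

definition buchi_automaton :: "('q, 'a) nba \<Rightarrow> bool" where
  "buchi_automaton A \<longleftrightarrow>
     finite (nba_states A) \<and>
     nba_initial A \<in> nba_states A \<and>
     nba_trans A \<subseteq> nba_states A \<times> UNIV \<times> nba_states A \<and>
     nba_accepting A \<subseteq> nba_states A"

definition nba_run :: "('q, 'a) nba \<Rightarrow> (nat \<Rightarrow> 'a) \<Rightarrow> (nat \<Rightarrow> 'q) \<Rightarrow> bool" where
  "nba_run A w \<rho> \<longleftrightarrow>
     \<rho> 0 = nba_initial A \<and> (\<forall>i. (\<rho> i, w i, \<rho> (Suc i)) \<in> nba_trans A)"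

definition nba_accepts :: "('q, 'a) nba \<Rightarrow> (nat \<Rightarrow> 'a) \<Rightarrow> bool" where
  "nba_accepts A w \<longleftrightarrow>
     (\<exists>\<rho>. nba_run A w \<rho> \<and> (\<exists>q\<in>nba_accepting A. \<exists>\<^sub>\<infinity>i. \<rho> i = q))"

text \<open>Taking states to be natural numbers, here and for transducers below, loses no generality:
  renaming the finitely many states does not change what is accepted or computed.\<close>

definition regular_function :: "(real \<Rightarrow> real) \<Rightarrow> bool" where
  "regular_function f \<longleftrightarrow>
     (\<exists>A :: (nat, bool) nba. buchi_automaton A \<and>
        (\<forall>\<alpha> \<beta>. nba_accepts A (interleave \<alpha> \<beta>) \<longleftrightarrow>
                 f (binary_value \<alpha>) = binary_value \<beta>))"

text \<open>A transition \<open>(p, a, None, q)\<close> reads \<open>a\<close> and writes nothing, a transition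
  \<open>(p, a, Some b, q)\<close> reads \<open>a\<close> and writes \<open>b\<close>.\<close>

record ('q, 'a, 'b) transducer =
  td_states :: "'q set"
  td_initial :: 'q
  td_trans :: "('q \<times> 'a \<times> 'b option \<times> 'q) set"

definition finite_state_transducer :: "('q, 'a, 'b) transducer \<Rightarrow> bool" where
  "finite_state_transducer T \<longleftrightarrow>
     finite (td_states T) \<and>
     td_initial T \<in> td_states T \<and>
     td_trans T \<subseteq> td_states T \<times> UNIV \<times> UNIV \<times> td_states T"

text \<open>\<open>td_run T D \<alpha> \<rho> \<beta>\<close>: the state sequence \<open>\<rho>\<close> is an infinite run with delay \<open>D\<close> on input
  \<open>\<alpha>\<close> that writes \<open>\<beta>\<close>. The delay is enforced here: only non-writing transitions are
  available in the first \<open>D\<close> steps, and only writing ones afterwards.\<close>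

definition td_run ::
  "('q, 'a, 'b) transducer \<Rightarrow> nat \<Rightarrow> (nat \<Rightarrow> 'a) \<Rightarrow> (nat \<Rightarrow> 'q) \<Rightarrow> (nat \<Rightarrow> 'b) \<Rightarrow> bool" where
  "td_run T D \<alpha> \<rho> \<beta> \<longleftrightarrow>
     \<rho> 0 = td_initial T \<and>
     (\<forall>i<D. (\<rho> i, \<alpha> i, None, \<rho> (Suc i)) \<in> td_trans T) \<and>
     (\<forall>i\<ge>D. (\<rho> i, \<alpha> i, Some (\<beta> (i - D)), \<rho> (Suc i)) \<in> td_trans T)"

definition td_computes ::
  "('q, bool, bool) transducer \<Rightarrow> nat \<Rightarrow> (real \<Rightarrow> real) \<Rightarrow> bool" where
  "td_computes T D f \<longleftrightarrow>
     (\<forall>x\<in>{0..1}. \<forall>\<alpha>. represents \<alpha> x \<longrightarrow>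
        (\<exists>\<rho> \<beta>. td_run T D \<alpha> \<rho> \<beta>) \<and>
        (\<forall>\<rho> \<beta>. td_run T D \<alpha> \<rho> \<beta> \<longrightarrow> represents \<beta> (f x)))"

definition transducer_computable :: "(real \<Rightarrow> real) \<Rightarrow> bool" where
  "transducer_computable f \<longleftrightarrow>
     (\<exists>(T :: (nat, bool, bool) transducer) D.
        finite_state_transducer T \<and> td_computes T D f)"

end

theory Submission
  imports Defs "HOL-Library.Infinite_Set"
begin

text \<open>The graph of a continuous \<open>f\<close> is closed in Cantor space. Hence, once the states with empty
  language are deleted from a Buechi automaton for it, every infinite run, accepting or not, is
  over a point of the graph, and the automaton, read as a machine that consumes \<open>\<alpha>\<close> and guesses
  \<open>\<beta>\<close>, is a transducer with delay 0.

  Conversely, the runs of a transducer form a compact set, which makes \<open>f\<close> continuous. Its graph is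
  recognised by guessing a run together with its output \<open>\<gamma>\<close> and checking that \<open>\<gamma>\<close> and \<open>\<beta>\<close> have the
  same value, i.e. that the scaled differences of their prefixes stay in \<open>{-1, 0, 1}\<close>; the last
  \<open>D\<close> letters of \<open>\<beta>\<close> are buffered to make up for the delay.\<close>

section \<open>Binary representations\<close>

lemma summable_binary: "summable (\<lambda>s. of_bool (\<alpha> s) * (1/2::real) ^ (s + 1))"
  by (rule summable_comparison_test'[where g = "\<lambda>s. (1/2::real) ^ s" and N = 0])
    (auto intro!: summable_geometric simp: of_bool_def)

lemma binary_value_bounds: "binary_value \<alpha> \<in> {0..1}"
proof -
  have "(\<lambda>s. (1/2::real) ^ (s + 1)) sums 1"
    using power_half_series by simp
  then have "binary_value \<alpha> \<le> 1"
    unfolding binary_value_def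
    by (subst sums_unique, assumption, intro suminf_le summable_binary)
      (auto simp: of_bool_def sums_iff)
  moreover have "0 \<le> binary_value \<alpha>"
    unfolding binary_value_def by (intro suminf_nonneg summable_binary) auto
  ultimately show ?thesis by simp
qed

lemma binary_value_split:
  "binary_value \<alpha> =
     (\<Sum>s<n. of_bool (\<alpha> s) * (1/2) ^ (s + 1)) + (1/2) ^ n * binary_value (\<lambda>s. \<alpha> (s + n))"
proof -
  have "binary_value \<alpha> = (\<Sum>s. of_bool (\<alpha> (s + n)) * (1/2) ^ (s + n + 1)) +
      (\<Sum>s<n. of_bool (\<alpha> s) * (1/2) ^ (s + 1))"
    unfolding binary_value_def by (rule suminf_split_initial_segment[OF summable_binary])
  also have "(\<Sum>s. of_bool (\<alpha> (s + n)) * (1/2::real) ^ (s + n + 1)) =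
      (\<Sum>s. (1/2) ^ n * (of_bool (\<alpha> (s + n)) * (1/2) ^ (s + 1)))"
    by (simp add: power_add mult_ac)
  also have "\<dots> = (1/2) ^ n * binary_value (\<lambda>s. \<alpha> (s + n))"
    unfolding binary_value_def by (rule suminf_mult[OF summable_binary])
  finally show ?thesis by simp
qed

text \<open>The common prefix cancels, and the two tails have values in \<open>[0,1]\<close> scaled
  by \<open>(1/2) ^ n\<close>. This is the continuity of evaluation on Cantor space.\<close>

lemma binary_value_dist_le:
  assumes "\<And>i. i < n \<Longrightarrow> \<alpha> i = \<beta> i"
  shows "\<bar>binary_value \<alpha> - binary_value \<beta>\<bar> \<le> (1/2) ^ n"
proof -
  let ?a = "binary_value (\<lambda>s. \<alpha> (s + n))" and ?b = "binary_value (\<lambda>s. \<beta> (s + n))"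
  have "binary_value \<alpha> - binary_value \<beta> = (1/2) ^ n * (?a - ?b)"
    using binary_value_split[of \<alpha> n] binary_value_split[of \<beta> n] assms
    by (simp add: algebra_simps)
  moreover have "\<bar>?a - ?b\<bar> \<le> 1"
    using binary_value_bounds[of "\<lambda>s. \<alpha> (s + n)"] binary_value_bounds[of "\<lambda>s. \<beta> (s + n)"]
    by auto
  ultimately show ?thesis by (simp add: abs_mult mult_left_le)
qed

lemma eq_if_dist_le_half_power:
  fixes x y :: real
  assumes "\<And>n. \<bar>x - y\<bar> \<le> C * (1/2) ^ n"
  shows "x = y"
proof -
  have "(\<lambda>n. C * (1/2::real) ^ n) \<longlonglongrightarrow> C * 0"
    by (intro tendsto_mult tendsto_const LIMSEQ_power_zero) simp
  then have "\<bar>x - y\<bar> \<le> 0"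
    using assms by (intro LIMSEQ_le_const) auto
  then show ?thesis by simp
qed

text \<open>Greedy expansion: the remainder after \<open>n\<close> digits, scaled by
  \<open>2 ^ n\<close>, so that the next digit is 1 exactly when it is at least
  \<open>1/2\<close>.\<close>

primrec binary_remainder :: "real \<Rightarrow> nat \<Rightarrow> real" where
  "binary_remainder x 0 = x"
| "binary_remainder x (Suc n) =
     2 * binary_remainder x n - of_bool (binary_remainder x n \<ge> 1/2)"

lemma ex_binary_representation:
  assumes "x \<in> {0..1}"
  shows "\<exists>\<alpha>. binary_value \<alpha> = x"
proof -
  define \<alpha> where "\<alpha> n \<longleftrightarrow> binary_remainder x n \<ge> 1/2" for n
  \<comment> \<open>The upper bound is weak so that \<open>x = 1\<close> is covered: its remainder
    stays 1 and every digit is 1.\<close>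
  have bounds: "0 \<le> binary_remainder x n \<and> binary_remainder x n \<le> 1" for n
    by (induction n) (use assms in \<open>auto simp: of_bool_def\<close>)
  have expand: "x = (\<Sum>s<n. of_bool (\<alpha> s) * (1/2) ^ (s + 1)) + (1/2) ^ n * binary_remainder x n" for n
    by (induction n) (auto simp: \<alpha>_def algebra_simps)
  have "\<bar>binary_value \<alpha> - x\<bar> \<le> 1 * (1/2) ^ n" for n
  proof -
    let ?r = "binary_value (\<lambda>s. \<alpha> (s + n)) - binary_remainder x n"
    have "binary_value \<alpha> - x = (1/2) ^ n * ?r"
      using binary_value_split[of \<alpha> n] expand[of n] by (simp add: algebra_simps)
    moreover have "\<bar>?r\<bar> \<le> 1"
      using binary_value_bounds[of "\<lambda>s. \<alpha> (s + n)"] bounds[of n] by auto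
    ultimately show ?thesis by (simp add: abs_mult mult_left_le)
  qed
  then show ?thesis using eq_if_dist_le_half_power by blast
qed

text \<open>This is \<open>2 ^ n\<close> times the difference of the two truncations to
  \<open>n\<close> digits. The Horner form keeps it an integer and lets an automaton update it
  letter by letter.\<close>

primrec prefix_difference :: "(nat \<Rightarrow> bool) \<Rightarrow> (nat \<Rightarrow> bool) \<Rightarrow> nat \<Rightarrow> int" where
  "prefix_difference \<alpha> \<beta> 0 = 0"
| "prefix_difference \<alpha> \<beta> (Suc n) = 2 * prefix_difference \<alpha> \<beta> n + of_bool (\<alpha> n) - of_bool (\<beta> n)"

lemma prefix_difference_eq_sum:
  "(1/2) ^ n * real_of_int (prefix_difference \<alpha> \<beta> n) =
     (\<Sum>s<n. of_bool (\<alpha> s) * (1/2) ^ (s + 1)) - (\<Sum>s<n. of_bool (\<beta> s) * (1/2) ^ (s + 1))"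
  by (induction n) (auto simp: algebra_simps)

lemma binary_value_diff:
  "binary_value \<alpha> - binary_value \<beta> = (1/2) ^ n * (real_of_int (prefix_difference \<alpha> \<beta> n) +
     binary_value (\<lambda>s. \<alpha> (s + n)) - binary_value (\<lambda>s. \<beta> (s + n)))"
  using binary_value_split[of \<alpha> n] binary_value_split[of \<beta> n] prefix_difference_eq_sum[of n \<alpha> \<beta>]
  by (simp add: algebra_simps)

text \<open>Tail values differ by at most 1, so equal values confine the scaled difference to three
  integers. Conversely, that confinement bounds the distance by \<open>2 * (1/2) ^ n\<close> for
  every \<open>n\<close>. Equality of values thus becomes a finite-state safety condition, which
  also covers the two expansions of a dyadic rational.\<close>

lemma binary_value_eq_iff:
  "binary_value \<alpha> = binary_value \<beta> \<longleftrightarrow> (\<forall>n. prefix_difference \<alpha> \<beta> n \<in> {-1..1})"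
proof
  assume eq: "binary_value \<alpha> = binary_value \<beta>"
  show "\<forall>n. prefix_difference \<alpha> \<beta> n \<in> {-1..1}"
  proof
    fix n
    have "real_of_int (prefix_difference \<alpha> \<beta> n) =
        binary_value (\<lambda>s. \<beta> (s + n)) - binary_value (\<lambda>s. \<alpha> (s + n))"
      using binary_value_diff[of \<alpha> \<beta> n] eq by simp
    then have "-1 \<le> real_of_int (prefix_difference \<alpha> \<beta> n)" "real_of_int (prefix_difference \<alpha> \<beta> n) \<le> 1"
      using binary_value_bounds[of "\<lambda>s. \<alpha> (s + n)"] binary_value_bounds[of "\<lambda>s. \<beta> (s + n)"]
      by auto
    then show "prefix_difference \<alpha> \<beta> n \<in> {-1..1}" by simp
  qed
next
  assume bounded: "\<forall>n. prefix_difference \<alpha> \<beta> n \<in> {-1..1}"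
  have "\<bar>binary_value \<alpha> - binary_value \<beta>\<bar> \<le> 2 * (1/2) ^ n" for n
  proof -
    have "-1 \<le> real_of_int (prefix_difference \<alpha> \<beta> n)" "real_of_int (prefix_difference \<alpha> \<beta> n) \<le> 1"
      using bounded[rule_format, of n] by auto
    then have "\<bar>real_of_int (prefix_difference \<alpha> \<beta> n) +
        binary_value (\<lambda>s. \<alpha> (s + n)) - binary_value (\<lambda>s. \<beta> (s + n))\<bar> \<le> 2"
      using binary_value_bounds[of "\<lambda>s. \<alpha> (s + n)"] binary_value_bounds[of "\<lambda>s. \<beta> (s + n)"]
      by auto
    then show ?thesis
      by (subst binary_value_diff[of \<alpha> \<beta> n]) (simp add: abs_mult)
  qed
  then show "binary_value \<alpha> = binary_value \<beta>" by (rule eq_if_dist_le_half_power)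
qed

section \<open>From automata to transducers\<close>

lemma interleave_even [simp]: "interleave \<alpha> \<beta> (2 * n) = \<alpha> n"
  and interleave_odd [simp]: "interleave \<alpha> \<beta> (Suc (2 * n)) = \<beta> n"
  by (auto simp: interleave_def)

lemma interleave_even_odd: "interleave (\<lambda>i. w (2 * i)) (\<lambda>i. w (Suc (2 * i))) = w"
  by (auto simp: interleave_def fun_eq_iff)

lemma all_nat_even_odd: "(\<forall>n. P n) \<longleftrightarrow> (\<forall>n. P (2 * n) \<and> P (Suc (2 * n)))"
  by (metis oddE evenE Suc_eq_plus1)

text \<open>The values of the approximating words converge to those of \<alpha> and \<beta>, and
  continuity carries the graph equation to the limit.\<close>

lemma graph_closed:
  assumes cont: "continuous_on {0..1} f"
    and approx: "\<And>n. \<exists>\<alpha>' \<beta>'. (\<forall>i<n. \<alpha>' i = \<alpha> i \<and> \<beta>' i = \<beta> i) \<and>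
                   f (binary_value \<alpha>') = binary_value \<beta>'"
  shows "f (binary_value \<alpha>) = binary_value \<beta>"
proof -
  obtain A B where AB: "\<And>n i. i < n \<Longrightarrow> A n i = \<alpha> i" "\<And>n i. i < n \<Longrightarrow> B n i = \<beta> i"
    and graph: "\<And>n. f (binary_value (A n)) = binary_value (B n)"
    using approx by metis
  have lim: "(\<lambda>n. binary_value (X n)) \<longlonglongrightarrow> binary_value \<xi>"
    if "\<And>n i. i < n \<Longrightarrow> X n i = \<xi> i" for X \<xi>
  proof (rule LIMSEQ_I)
    fix r :: real assume "0 < r"
    then obtain N where N: "(1/2) ^ N < r"
      using real_arch_pow_inv[of r "1/2"] by auto
    have "norm (binary_value (X n) - binary_value \<xi>) < r" if "n \<ge> N" for n
    proof -
      have "norm (binary_value (X n) - binary_value \<xi>) \<le> (1/2) ^ n"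
        using binary_value_dist_le[of n "X n" \<xi>] \<open>\<And>n i. i < n \<Longrightarrow> X n i = \<xi> i\<close> by simp
      also have "\<dots> \<le> (1/2) ^ N" using that by (intro power_decreasing) auto
      finally show ?thesis using N by simp
    qed
    then show "\<exists>N. \<forall>n\<ge>N. norm (binary_value (X n) - binary_value \<xi>) < r" by blast
  qed
  have "(\<lambda>n. f (binary_value (A n))) \<longlonglongrightarrow> f (binary_value \<alpha>)"
    using lim[of A \<alpha>] AB(1) binary_value_bounds
    by (intro continuous_on_tendsto_compose[OF cont]) auto
  moreover have "(\<lambda>n. f (binary_value (A n))) \<longlonglongrightarrow> binary_value \<beta>"
    using lim[of B \<beta>] AB(2) graph by simp
  ultimately show ?thesis by (rule LIMSEQ_unique)
qed

section \<open>Live states and the continuation of run prefixes to accepting runs\<close>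

definition live :: "('q, 'a) nba \<Rightarrow> 'q \<Rightarrow> bool" where
  "live A q \<longleftrightarrow> (\<exists>w \<rho>. \<rho> 0 = q \<and> (\<forall>i. (\<rho> i, w i, \<rho> (Suc i)) \<in> nba_trans A) \<and>
     (\<exists>q\<in>nba_accepting A. \<exists>\<^sub>\<infinity>i. \<rho> i = q))"

lemma INFM_nat_shift: "(\<exists>\<^sub>\<infinity>i. P (i + k)) \<longleftrightarrow> (\<exists>\<^sub>\<infinity>i::nat. P i)"
  unfolding cofinite_eq_sequentially frequently_def
  using eventually_sequentially_seg[of "\<lambda>i. \<not> P i" k] by simp

lemma live_suffix:
  assumes "nba_run A w \<rho>" "q \<in> nba_accepting A" "\<exists>\<^sub>\<infinity>i. \<rho> i = q"
  shows "live A (\<rho> n)"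
  unfolding live_def
proof (intro exI conjI bexI)
  show "\<rho> (0 + n) = \<rho> n" by simp
  show "\<forall>i. (\<rho> (i + n), w (i + n), \<rho> (Suc i + n)) \<in> nba_trans A"
    using assms(1) by (simp add: nba_run_def)
  show "\<exists>\<^sub>\<infinity>i. \<rho> (i + n) = q"
    using assms(3) by (subst INFM_nat_shift[of "\<lambda>i. \<rho> i = q"])
qed (fact assms(2))

text \<open>An accepting continuation from \<open>\<rho> n\<close> is spliced onto the first
  \<open>n\<close> steps. The given run may itself fail to accept, so this turns mere runs into
  limits of accepted words.\<close>

lemma accepts_prefix_extension:
  assumes run: "nba_run A w \<rho>" and live: "live A (\<rho> n)"
  shows "\<exists>w'. (\<forall>i<n. w' i = w i) \<and> nba_accepts A w'"
proof -
  obtain u \<sigma> q where \<sigma>: "\<sigma> 0 = \<rho> n" "\<And>i. (\<sigma> i, u i, \<sigma> (Suc i)) \<in> nba_trans A"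
    and q: "q \<in> nba_accepting A" "\<exists>\<^sub>\<infinity>i. \<sigma> i = q"
    using live unfolding live_def by blast
  define w' where "w' i = (if i < n then w i else u (i - n))" for i
  define \<rho>' where "\<rho>' i = (if i < n then \<rho> i else \<sigma> (i - n))" for i
  have "(\<rho>' i, w' i, \<rho>' (Suc i)) \<in> nba_trans A" for i
  proof -
    \<comment> \<open>The middle case is the seam, where \<open>\<sigma> 0 = \<rho> n\<close> joins
      the two runs.\<close>
    consider "Suc i < n" | "Suc i = n" | "n \<le> i" by linarith
    then show ?thesis
      using run \<sigma> by cases (auto simp: \<rho>'_def w'_def nba_run_def Suc_diff_le)
  qed
  moreover have "\<rho>' 0 = nba_initial A"
    using run \<sigma>(1) by (cases n) (auto simp: \<rho>'_def nba_run_def)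
  moreover have "\<exists>\<^sub>\<infinity>i. \<rho>' i = q"
    using q(2) by (subst INFM_nat_shift[of _ n, symmetric]) (simp add: \<rho>'_def)
  ultimately have "nba_accepts A w'"
    using q(1) unfolding nba_accepts_def nba_run_def by blast
  then show ?thesis by (intro exI[of _ w']) (auto simp: w'_def)
qed

lemma transducer_computable_if_continuous_regular:
  assumes f: "f \<in> {0..1} \<rightarrow> {0..1}"
    and cont: "continuous_on {0..1} f" and "regular_function f"
  shows "transducer_computable f"
proof -
  obtain A :: "(nat, bool) nba" where A: "buchi_automaton A"
    and acc: "\<And>\<alpha> \<beta>. nba_accepts A (interleave \<alpha> \<beta>) \<longleftrightarrow> f (binary_value \<alpha>) = binary_value \<beta>"
    using \<open>regular_function f\<close> unfolding regular_function_def by blast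
  \<comment> \<open>One step contracts the two automaton steps that read \<open>a\<close> and then
    the guessed \<open>b\<close>. Only the state after both letters has to be live, since runs will
    be cut at even positions.\<close>
  define T :: "(nat, bool, bool) transducer" where
    "T = \<lparr>td_states = nba_states A, td_initial = nba_initial A,
          td_trans = {(p, a, Some b, r) | p a b r. live A r \<and>
            (\<exists>q. (p, a, q) \<in> nba_trans A \<and> (q, b, r) \<in> nba_trans A)}\<rparr>"
  have "finite_state_transducer T"
    using A unfolding finite_state_transducer_def buchi_automaton_def T_def by auto
  moreover have "td_computes T 0 f"
    unfolding td_computes_def represents_def
  proof (intro ballI allI impI conjI)
    fix x \<alpha> assume x: "x \<in> {0..1::real}" and \<alpha>: "binary_value \<alpha> = x"
    obtain \<beta> where "binary_value \<beta> = f x"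
      using ex_binary_representation[of "f x"] f x by blast
    then obtain \<rho> q where \<rho>: "nba_run A (interleave \<alpha> \<beta>) \<rho>"
      and q: "q \<in> nba_accepting A" "\<exists>\<^sub>\<infinity>i. \<rho> i = q"
      using acc[of \<alpha> \<beta>] \<alpha> unfolding nba_accepts_def by auto
    have step: "(\<rho> i, interleave \<alpha> \<beta> i, \<rho> (Suc i)) \<in> nba_trans A" for i
      using \<rho> unfolding nba_run_def by blast
    \<comment> \<open>An accepting run witnesses the liveness of all its own states, so its even
      positions form a transducer run.\<close>
    have "td_run T 0 \<alpha> (\<lambda>i. \<rho> (2 * i)) \<beta>"
      unfolding td_run_def T_def
      using \<rho> step[of "2 * _"] step[of "Suc (2 * _)"] live_suffix[OF \<rho> q]
      by (auto simp: nba_run_def)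
    then show "\<exists>\<rho> \<beta>. td_run T 0 \<alpha> \<rho> \<beta>" by blast
  next
    fix x \<alpha> \<sigma> \<beta>
    assume \<alpha>: "binary_value \<alpha> = x" and run: "td_run T 0 \<alpha> \<sigma> \<beta>"
    \<comment> \<open>Choosing the contracted middle states restores an automaton run on the
      interleaved word, though not necessarily an accepting one.\<close>
    have "\<exists>q. (\<sigma> i, \<alpha> i, q) \<in> nba_trans A \<and> (q, \<beta> i, \<sigma> (Suc i)) \<in> nba_trans A" for i
      using run unfolding td_run_def T_def by auto
    then obtain \<mu> where \<mu>: "\<And>i. (\<sigma> i, \<alpha> i, \<mu> i) \<in> nba_trans A"
        "\<And>i. (\<mu> i, \<beta> i, \<sigma> (Suc i)) \<in> nba_trans A"
      by metis
    have live: "live A (\<sigma> (Suc i))" for i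
      using run unfolding td_run_def T_def by auto
    have "nba_run A (interleave \<alpha> \<beta>) (interleave \<sigma> \<mu>)"
      unfolding nba_run_def
    proof (intro conjI, goal_cases)
      case 1
      show ?case using run by (simp add: interleave_def td_run_def T_def)
    next
      case 2
      have "(interleave \<sigma> \<mu> (2 * n), interleave \<alpha> \<beta> (2 * n), interleave \<sigma> \<mu> (Suc (2 * n)))
          \<in> nba_trans A" for n
        using \<mu>(1) by simp
      moreover have "interleave \<sigma> \<mu> (Suc (Suc (2 * n))) = \<sigma> (Suc n)" for n
        using interleave_even[of \<sigma> \<mu> "Suc n"] by simp
      then have "(interleave \<sigma> \<mu> (Suc (2 * n)), interleave \<alpha> \<beta> (Suc (2 * n)),
          interleave \<sigma> \<mu> (Suc (Suc (2 * n)))) \<in> nba_trans A" for n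
        using \<mu>(2) by simp
      ultimately show ?case by (subst all_nat_even_odd) blast
    qed
    \<comment> \<open>Liveness is known for targets of transitions only, hence the cut at
      \<open>2 * Suc n\<close> and not at \<open>2 * n\<close>.\<close>
    then have extension: "\<exists>w. (\<forall>i<2 * Suc n. w i = interleave \<alpha> \<beta> i) \<and> nba_accepts A w" for n
      by (rule accepts_prefix_extension) (simp only: interleave_even live)
    have "f (binary_value \<alpha>) = binary_value \<beta>"
    proof (rule graph_closed[OF cont])
      fix n
      obtain w where w: "\<forall>i<2 * Suc n. w i = interleave \<alpha> \<beta> i" "nba_accepts A w"
        using extension by blast
      have "w (2 * i) = \<alpha> i \<and> w (Suc (2 * i)) = \<beta> i" if "i < n" for i
        using w(1) that by simp
      moreover have "f (binary_value (\<lambda>i. w (2 * i))) = binary_value (\<lambda>i. w (Suc (2 * i)))"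
        using w(2) acc[of "\<lambda>i. w (2 * i)" "\<lambda>i. w (Suc (2 * i))"]
        by (simp add: interleave_even_odd)
      ultimately show "\<exists>\<alpha>' \<beta>'. (\<forall>i<n. \<alpha>' i = \<alpha> i \<and> \<beta>' i = \<beta> i) \<and>
          f (binary_value \<alpha>') = binary_value \<beta>'"
        by (intro exI[of _ "\<lambda>i. w (2 * i)"] exI[of _ "\<lambda>i. w (Suc (2 * i))"]) simp
    qed
    then show "binary_value \<beta> = f x" using \<alpha> by simp
  qed
  ultimately show ?thesis unfolding transducer_computable_def by blast
qed

section \<open>From transducers to automata\<close>

text \<open>Compactness of the words over a finite set, stated as the existence of a cluster point.
  A prefix shared by infinitely many \<open>u k\<close> has, by the pigeonhole principle, a
  one-letter extension that is again shared by infinitely many.\<close>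

lemma Koenig_limit:
  fixes u :: "nat \<Rightarrow> nat \<Rightarrow> 'a"
  assumes fin: "finite S" and u: "\<And>k i. u k i \<in> S"
  shows "\<exists>w. \<forall>n. \<exists>\<^sub>\<infinity>k. \<forall>i<n. u k i = w i"
proof -
  define inf where "inf p \<longleftrightarrow> (\<exists>\<^sub>\<infinity>k. \<forall>i<length p. u k i = p ! i)" for p
  have extend: "\<exists>a. inf (p @ [a])" if "inf p" for p
  proof -
    let ?K = "{k. \<forall>i<length p. u k i = p ! i}"
    have "infinite ?K" using that unfolding inf_def frequently_cofinite .
    moreover have "finite ((\<lambda>k. u k (length p)) ` ?K)"
      using fin u by (intro finite_subset[OF _ fin]) auto
    ultimately obtain k where "infinite {k' \<in> ?K. u k' (length p) = u k (length p)}"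
      using pigeonhole_infinite[of ?K "\<lambda>k. u k (length p)"] by auto
    moreover have "{k' \<in> ?K. u k' (length p) = u k (length p)} \<subseteq>
        {k'. \<forall>i<length (p @ [u k (length p)]). u k' i = (p @ [u k (length p)]) ! i}"
      by (auto simp: nth_append less_Suc_eq)
    ultimately have "inf (p @ [u k (length p)])"
      unfolding inf_def frequently_cofinite by (rule infinite_super[rotated])
    then show ?thesis by blast
  qed
  define P where "P = rec_nat [] (\<lambda>_ p. p @ [SOME a. inf (p @ [a])])"
  have P: "P 0 = []" "\<And>n. P (Suc n) = P n @ [SOME a. inf (P n @ [a])]"
    by (auto simp: P_def)
  have len: "length (P n) = n" for n by (induction n) (auto simp: P)
  have inf: "inf (P n)" for n
  proof (induction n)
    case 0
    show ?case by (simp add: P inf_def frequently_cofinite)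
  next
    case (Suc n)
    show ?case unfolding P by (rule someI_ex[OF extend[OF Suc]])
  qed
  \<comment> \<open>The chosen prefixes are nested, so letter \<open>i\<close> of the limit can be
    read off \<open>P (Suc i)\<close>.\<close>
  have nth: "P n ! i = P (Suc i) ! i" if "i < n" for i n
    using that by (induction n) (auto simp: P(2) nth_append len less_Suc_eq)
  show ?thesis
  proof (intro exI allI)
    fix n
    show "\<exists>\<^sub>\<infinity>k. \<forall>i<n. u k i = P (Suc i) ! i"
      using inf[of n] nth[of _ n] unfolding inf_def len by simp
  qed
qed

text \<open>If sequential continuity failed at \<open>x\<close>, runs on representations of the bad
  points would have a cluster point. This is a run on a representation of \<open>x\<close>, so it
  writes a representation of \<open>f x\<close>, yet its output shares long prefixes with outputs
  whose values stay away from \<open>f x\<close>.\<close>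

lemma continuous_if_transducer_computable:
  assumes "transducer_computable f"
  shows "continuous_on {0..1} f"
proof -
  obtain T :: "(nat, bool, bool) transducer" and D
    where T: "finite_state_transducer T" and comp: "td_computes T D f"
    using assms unfolding transducer_computable_def by blast
  have "(\<lambda>k. f (X k)) \<longlonglongrightarrow> f x"
    if X: "\<And>k. X k \<in> {0..1}" and x: "x \<in> {0..1}" and lim: "X \<longlonglongrightarrow> x" for X x
  proof (rule ccontr)
    assume "\<not> (\<lambda>k. f (X k)) \<longlonglongrightarrow> f x"
    then obtain e where e: "e > 0" and freq: "\<forall>N. \<exists>k\<ge>N. \<bar>f (X k) - f x\<bar> \<ge> e"
      unfolding LIMSEQ_iff by (auto simp: not_less)
    \<comment> \<open>The indices \<open>r N\<close> need not increase strictly;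
      \<open>r N \<ge> N\<close> suffices for convergence to \<open>x\<close>.\<close>
    obtain r where r: "\<And>N. r N \<ge> N" "\<And>N. \<bar>f (X (r N)) - f x\<bar> \<ge> e"
      using freq by metis
    have Xr: "(\<lambda>N. X (r N)) \<longlonglongrightarrow> x"
    proof (rule filterlim_compose[OF lim])
      show "filterlim r at_top sequentially"
        by (rule filterlim_at_top_mono[OF filterlim_ident]) (simp add: r(1))
    qed
    have "\<forall>N. \<exists>\<alpha>. binary_value \<alpha> = X (r N)"
      using ex_binary_representation X by blast
    then obtain \<alpha> where \<alpha>: "\<And>N. binary_value (\<alpha> N) = X (r N)"
      by metis
    have "\<exists>\<rho> \<beta>. td_run T D (\<alpha> N) \<rho> \<beta>" for N
      using comp X \<alpha> unfolding td_computes_def represents_def by blast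
    then obtain \<rho> \<beta> where run: "\<And>N. td_run T D (\<alpha> N) (\<rho> N) (\<beta> N)"
      by metis
    have \<beta>: "binary_value (\<beta> N) = f (X (r N))" for N
      using comp X \<alpha> run unfolding td_computes_def represents_def by blast
    have \<rho>_states: "\<rho> N i \<in> td_states T" for N i
    proof -
      have "(\<rho> N i, \<alpha> N i, None, \<rho> N (Suc i)) \<in> td_trans T \<or>
          (\<rho> N i, \<alpha> N i, Some (\<beta> N (i - D)), \<rho> N (Suc i)) \<in> td_trans T"
        using run[of N] unfolding td_run_def by (meson not_less)
      then show ?thesis using T unfolding finite_state_transducer_def by blast
    qed
    have "finite (UNIV \<times> td_states T \<times> UNIV :: (bool \<times> nat \<times> bool) set)"
      using T unfolding finite_state_transducer_def by simp
    \<comment> \<open>Input, state and output letters are packed into one word so that all three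
      cluster along the same indices.\<close>
    from Koenig_limit[OF this, of "\<lambda>N i. (\<alpha> N i, \<rho> N i, \<beta> N i)"]
    obtain w where w: "\<And>n. \<exists>\<^sub>\<infinity>N. \<forall>i<n. (\<alpha> N i, \<rho> N i, \<beta> N i) = w i"
      using \<rho>_states by auto
    define a s b where "a i = fst (w i)" and "s i = fst (snd (w i))" and "b i = snd (snd (w i))" for i
    have close: "\<exists>N\<ge>M. \<forall>i<n. \<alpha> N i = a i \<and> \<rho> N i = s i \<and> \<beta> N i = b i" for n M
    proof -
      obtain N where "N \<ge> M" and N: "\<forall>i<n. (\<alpha> N i, \<rho> N i, \<beta> N i) = w i"
        using w[of n] unfolding INFM_nat_le by blast
      have "\<alpha> N i = a i \<and> \<rho> N i = s i \<and> \<beta> N i = b i" if "i < n" for i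
        using N[rule_format, OF that] by (metis a_def s_def b_def fst_conv snd_conv)
      then show ?thesis using \<open>N \<ge> M\<close> by blast
    qed
    \<comment> \<open>Some index is both late enough for \<open>X (r N)\<close> to be near
      \<open>x\<close> and such that \<open>\<alpha> N\<close> shares a long prefix with
      \<open>a\<close>.\<close>
    have "binary_value a = x"
    proof (rule ccontr)
      let ?d = "\<bar>binary_value a - x\<bar>"
      assume "binary_value a \<noteq> x"
      then have d: "?d / 2 > 0" by simp
      then obtain n where n: "(1/2) ^ n < ?d / 2" using real_arch_pow_inv[of "?d / 2" "1/2"] by auto
      obtain M where M: "\<And>N. N \<ge> M \<Longrightarrow> \<bar>X (r N) - x\<bar> < ?d / 2"
        using LIMSEQ_D[OF Xr d] by auto
      obtain N where "N \<ge> M" and N: "\<forall>i<n. \<alpha> N i = a i" using close by meson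
      have "\<bar>binary_value (\<alpha> N) - binary_value a\<bar> \<le> (1/2) ^ n"
        using N by (intro binary_value_dist_le) simp
      moreover have "?d \<le> \<bar>binary_value (\<alpha> N) - binary_value a\<bar> + \<bar>X (r N) - x\<bar>"
        unfolding \<alpha> by linarith
      ultimately have "?d < ?d / 2 + ?d / 2"
        using add_strict_mono[OF n M[OF \<open>N \<ge> M\<close>]] 
        by (meson add_right_mono le_less_trans)
      then show False by simp
    qed
    \<comment> \<open>Each transition involves only positions up to \<open>Suc i\<close>, so it is
      inherited from a single run that agrees with the limit that far.\<close>
    moreover have "td_run T D a s b"
      unfolding td_run_def
    proof (intro conjI allI impI)
      show "s 0 = td_initial T"
        using close[of 0 1] run unfolding td_run_def by (metis less_numeral_extra(1))
    next
      fix i assume i: "i < D"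
      obtain N where "\<forall>j<Suc (Suc i). \<alpha> N j = a j \<and> \<rho> N j = s j \<and> \<beta> N j = b j"
        using close[of 0 "Suc (Suc i)"] by blast
      moreover have "(\<rho> N i, \<alpha> N i, None, \<rho> N (Suc i)) \<in> td_trans T"
        using run[of N] i unfolding td_run_def by blast
      ultimately show "(s i, a i, None, s (Suc i)) \<in> td_trans T" by simp
    next
      fix i assume i: "D \<le> i"
      obtain N where "\<forall>j<Suc (Suc i). \<alpha> N j = a j \<and> \<rho> N j = s j \<and> \<beta> N j = b j"
        using close[of 0 "Suc (Suc i)"] by blast
      moreover have "(\<rho> N i, \<alpha> N i, Some (\<beta> N (i - D)), \<rho> N (Suc i)) \<in> td_trans T"
        using run[of N] i unfolding td_run_def by blast
      ultimately show "(s i, a i, Some (b (i - D)), s (Suc i)) \<in> td_trans T" by simp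
    qed
    ultimately have b: "binary_value b = f x"
      using comp x unfolding td_computes_def represents_def by blast
    obtain n where n: "(1/2) ^ n < e" using real_arch_pow_inv[of e "1/2"] e by auto
    obtain N where N: "\<forall>i<n. \<beta> N i = b i" using close by meson
    have "\<bar>binary_value (\<beta> N) - binary_value b\<bar> \<le> (1/2) ^ n"
      using N by (intro binary_value_dist_le) simp
    with n r(2)[of N] \<beta>[of N] b show False by simp
  qed
  then show ?thesis
    unfolding continuous_on_def tendsto_at_iff_sequentially comp_def by blast
qed

text \<open>\<open>E\<close> acts as a machine reading two letters at once. The automaton remembers
  the first letter of a pair and moves when the second arrives. All its states accept, because an
  infinite run through finitely many states repeats one of them infinitely often.\<close>

lemma safety_relation_recognizable:
  fixes E :: "('s \<times> 'a::finite \<times> 'a \<times> 's) set"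
  assumes fin: "finite S" and s0: "s0 \<in> S" and E: "E \<subseteq> S \<times> UNIV \<times> UNIV \<times> S"
  shows "\<exists>A :: (nat, 'a) nba. buchi_automaton A \<and>
    (\<forall>\<alpha> \<beta>. nba_accepts A (interleave \<alpha> \<beta>) \<longleftrightarrow>
       (\<exists>\<sigma>. \<sigma> 0 = s0 \<and> (\<forall>i. (\<sigma> i, \<alpha> i, \<beta> i, \<sigma> (Suc i)) \<in> E)))"
proof -
  let ?Q = "S \<times> (UNIV :: 'a option set)"
  have finQ: "finite ?Q" using fin by simp
  then obtain h :: "'s \<times> 'a option \<Rightarrow> nat" where h: "inj_on h ?Q"
    using finite_imp_inj_to_nat_seg by blast
  have h_eq: "h (p, x) = h (q, y) \<longleftrightarrow> p = q \<and> x = y" if "p \<in> S" "q \<in> S" for p q x y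
    using inj_on_eq_iff[OF h, of "(p, x)" "(q, y)"] that by simp
  \<comment> \<open>\<open>None\<close> marks the positions before a pair and \<open>Some a\<close>
    those after its first letter \<open>a\<close>; \<open>h\<close> encodes both as natural
    numbers.\<close>
  define A where "A = \<lparr>nba_states = h ` ?Q, nba_initial = h (s0, None),
    nba_trans = {(h (p, None), a, h (p, Some a)) | p a. p \<in> S} \<union>
      {(h (p, Some a), b, h (q, None)) | p a b q. (p, a, b, q) \<in> E},
    nba_accepting = h ` ?Q\<rparr>"
  have "buchi_automaton A"
    using finQ s0 E unfolding buchi_automaton_def A_def by auto
  moreover have "nba_accepts A (interleave \<alpha> \<beta>) \<longleftrightarrow>
      (\<exists>\<sigma>. \<sigma> 0 = s0 \<and> (\<forall>i. (\<sigma> i, \<alpha> i, \<beta> i, \<sigma> (Suc i)) \<in> E))" for \<alpha> \<beta>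
  proof
    assume "nba_accepts A (interleave \<alpha> \<beta>)"
    then obtain \<rho> where init: "\<rho> 0 = h (s0, None)"
      and step: "\<And>i. (\<rho> i, interleave \<alpha> \<beta> i, \<rho> (Suc i)) \<in> nba_trans A"
      unfolding nba_accepts_def nba_run_def by (auto simp: A_def)
    have two_steps: "\<exists>q\<in>S. \<rho> (2 * Suc i) = h (q, None) \<and> (p, \<alpha> i, \<beta> i, q) \<in> E"
      if p: "p \<in> S" "\<rho> (2 * i) = h (p, None)" for p i
    proof -
      have "\<rho> (Suc (2 * i)) = h (p, Some (\<alpha> i))"
        using step[of "2 * i"] p E by (auto simp: A_def h_eq)
      then show ?thesis
        using step[of "Suc (2 * i)"] p E by (auto simp: A_def h_eq)
    qed
    define \<sigma> where "\<sigma> i = (THE p. p \<in> S \<and> \<rho> (2 * i) = h (p, None))" for i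
    have \<sigma>: "\<sigma> i = p" if "p \<in> S" "\<rho> (2 * i) = h (p, None)" for p i
      unfolding \<sigma>_def using that by (intro the_equality) (auto simp: h_eq)
    have inv: "\<exists>p\<in>S. \<rho> (2 * i) = h (p, None)" for i
    proof (induction i)
      case 0
      show ?case using init s0 by auto
    next
      case (Suc i)
      then show ?case using two_steps by blast
    qed
    have "(\<sigma> i, \<alpha> i, \<beta> i, \<sigma> (Suc i)) \<in> E" for i
      using inv[of i] two_steps[of _ i] \<sigma> by metis
    moreover have "\<sigma> 0 = s0" using \<sigma>[of s0 0] s0 init by simp
    ultimately show "\<exists>\<sigma>. \<sigma> 0 = s0 \<and> (\<forall>i. (\<sigma> i, \<alpha> i, \<beta> i, \<sigma> (Suc i)) \<in> E)" by blast
  next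
    assume "\<exists>\<sigma>. \<sigma> 0 = s0 \<and> (\<forall>i. (\<sigma> i, \<alpha> i, \<beta> i, \<sigma> (Suc i)) \<in> E)"
    then obtain \<sigma> where \<sigma>: "\<sigma> 0 = s0" "\<And>i. (\<sigma> i, \<alpha> i, \<beta> i, \<sigma> (Suc i)) \<in> E" by blast
    have \<sigma>S: "\<sigma> i \<in> S" for i using \<sigma>(2) E by blast
    define \<rho> where "\<rho> = interleave (\<lambda>i. h (\<sigma> i, None)) (\<lambda>i. h (\<sigma> i, Some (\<alpha> i)))"
    have \<rho>: "\<rho> (2 * n) = h (\<sigma> n, None)" "\<rho> (Suc (2 * n)) = h (\<sigma> n, Some (\<alpha> n))"
      "\<rho> (Suc (Suc (2 * n))) = h (\<sigma> (Suc n), None)" for n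
      using interleave_even[of _ _ "Suc n"] by (auto simp: \<rho>_def)
    have "\<forall>n. (\<rho> n, interleave \<alpha> \<beta> n, \<rho> (Suc n)) \<in> nba_trans A"
    proof (subst all_nat_even_odd, intro allI conjI)
      fix n
      show "(\<rho> (2 * n), interleave \<alpha> \<beta> (2 * n), \<rho> (Suc (2 * n))) \<in> nba_trans A"
        using \<sigma>S by (auto simp: \<rho> A_def)
      show "(\<rho> (Suc (2 * n)), interleave \<alpha> \<beta> (Suc (2 * n)), \<rho> (Suc (Suc (2 * n)))) \<in> nba_trans A"
        using \<sigma>(2)[of n] unfolding \<rho> interleave_odd by (auto simp: A_def)
    qed
    then have "nba_run A (interleave \<alpha> \<beta>) \<rho>"
      using \<rho>(1)[of 0] \<sigma>(1) by (simp add: nba_run_def A_def)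
    moreover have "\<forall>n. \<rho> n \<in> h ` ?Q"
      by (subst all_nat_even_odd) (use \<sigma>S in \<open>auto simp: \<rho>\<close>)
    then have range: "range \<rho> \<subseteq> h ` ?Q" by auto
    have "\<exists>q\<in>h ` ?Q. \<exists>\<^sub>\<infinity>i. \<rho> i = q"
    proof -
      have "finite (range \<rho>)"
        using range finQ by (meson finite_imageI finite_subset)
      then obtain k where "infinite {i \<in> UNIV. \<rho> i = \<rho> k}"
        using pigeonhole_infinite[of "UNIV :: nat set" \<rho>] by auto
      then have "\<exists>\<^sub>\<infinity>i. \<rho> i = \<rho> k" unfolding frequently_cofinite by simp
      moreover have "\<rho> k \<in> h ` ?Q" using range by blast
      ultimately show ?thesis by blast
    qed
    ultimately show "nba_accepts A (interleave \<alpha> \<beta>)"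
      unfolding nba_accepts_def by (auto simp: A_def)
  qed
  ultimately show ?thesis by blast
qed

text \<open>A state \<open>(p, bs, d)\<close> holds the transducer state, a queue of the letters of
  \<beta> not yet compared, and the scaled difference of the prefixes compared so far.\<close>

lemma regular_if_transducer_computable:
  assumes "transducer_computable f"
  shows "regular_function f"
proof -
  obtain T :: "(nat, bool, bool) transducer" and D
    where T: "finite_state_transducer T" and comp: "td_computes T D f"
    using assms unfolding transducer_computable_def by blast
  \<comment> \<open>Some run on \<alpha> exists and every run writes the right value, so guessing a
    single run is enough.\<close>
  have graph: "f (binary_value \<alpha>) = binary_value \<beta> \<longleftrightarrow>
      (\<exists>\<rho> \<gamma>. td_run T D \<alpha> \<rho> \<gamma> \<and> binary_value \<gamma> = binary_value \<beta>)" for \<alpha> \<beta>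
    using comp binary_value_bounds[of \<alpha>] unfolding td_computes_def represents_def by metis
  let ?B = "{bs :: bool list. set bs \<subseteq> UNIV \<and> length bs \<le> D}"
  define S where "S = td_states T \<times> ?B \<times> {-1..1::int}"
  \<comment> \<open>The first set fills the queue during the delay; the second appends
    \<open>b\<close> and compares the written \<open>c\<close> with the oldest letter. Appending
    before taking \<open>hd\<close> covers \<open>D = 0\<close>, where the queue is empty.\<close>
  define E where "E =
    {((p, bs, d), a, b, (q, bs @ [b], d)) | p bs d a b q.
        (p, bs, d) \<in> S \<and> length bs < D \<and> (p, a, None, q) \<in> td_trans T} \<union>
    {((p, bs, d), a, b, (q, tl (bs @ [b]), d')) | p bs d a b q c d'.
        (p, bs, d) \<in> S \<and> length bs = D \<and> (p, a, Some c, q) \<in> td_trans T \<and>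
        d' = 2 * d + of_bool c - of_bool (hd (bs @ [b])) \<and> d' \<in> {-1..1}}"
  define s0 :: "nat \<times> bool list \<times> int" where "s0 = (td_initial T, [], 0)"
  have "finite ?B" by (intro finite_lists_length_le) simp
  then have finS: "finite S"
    using T unfolding S_def finite_state_transducer_def by (intro finite_cartesian_product) auto
  have s0: "s0 \<in> S"
    using T unfolding S_def s0_def finite_state_transducer_def by simp
  have E: "E \<subseteq> S \<times> UNIV \<times> UNIV \<times> S"
    using T unfolding S_def E_def finite_state_transducer_def by auto
  have E_late: "\<exists>c. (p, a, Some c, q) \<in> td_trans T \<and>
      d' = 2 * d + of_bool c - of_bool (hd (bs @ [b])) \<and> d' \<in> {-1..1} \<and> bs' = tl (bs @ [b])"
    if "((p, bs, d), a, b, (q, bs', d')) \<in> E" "length bs = D" for p bs d a b q bs' d'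
    using that unfolding E_def Un_iff mem_Collect_eq prod.inject by (metis less_irrefl)
  have "(\<exists>\<sigma>. \<sigma> 0 = s0 \<and> (\<forall>i. (\<sigma> i, \<alpha> i, \<beta> i, \<sigma> (Suc i)) \<in> E)) \<longleftrightarrow>
      f (binary_value \<alpha>) = binary_value \<beta>" for \<alpha> \<beta>
    unfolding graph
  proof
    assume "\<exists>\<sigma>. \<sigma> 0 = s0 \<and> (\<forall>i. (\<sigma> i, \<alpha> i, \<beta> i, \<sigma> (Suc i)) \<in> E)"
    then obtain \<sigma> where init: "\<sigma> 0 = s0" and step: "\<And>i. (\<sigma> i, \<alpha> i, \<beta> i, \<sigma> (Suc i)) \<in> E" by blast
    define \<rho> bs d where "\<rho> i = fst (\<sigma> i)" and "bs i = fst (snd (\<sigma> i))" and "d i = snd (snd (\<sigma> i))" for i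
    have \<sigma>: "\<sigma> i = (\<rho> i, bs i, d i)" for i by (simp add: \<rho>_def bs_def d_def)
    have early: "(\<rho> i, \<alpha> i, None, \<rho> (Suc i)) \<in> td_trans T" "bs (Suc i) = bs i @ [\<beta> i]"
        "d (Suc i) = d i" if "length (bs i) < D" for i
      using step[of i] that unfolding \<sigma> E_def by auto
    have late: "\<exists>c. (\<rho> i, \<alpha> i, Some c, \<rho> (Suc i)) \<in> td_trans T \<and>
          d (Suc i) = 2 * d i + of_bool c - of_bool (hd (bs i @ [\<beta> i])) \<and>
          d (Suc i) \<in> {-1..1} \<and> bs (Suc i) = tl (bs i @ [\<beta> i])" if "length (bs i) = D" for i
      using E_late step[of i] that unfolding \<sigma> by blast
    \<comment> \<open>Truncated subtraction makes this one formula valid during the delay, when the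
      queue holds all letters read, and afterwards.\<close>
    have bs: "bs i = map \<beta> [i - D..<i]" for i
    proof (induction i)
      case 0
      show ?case using init by (simp add: bs_def s0_def)
    next
      case (Suc i)
      show ?case
      proof (cases "i < D")
        case True
        then show ?thesis using early(2)[of i] Suc by simp
      next
        case False
        then have "bs (Suc i) = tl (map \<beta> [i - D..<Suc i])"
          using late[of i] Suc by auto
        then show ?thesis using False by (simp add: Suc_diff_le map_tl[symmetric] del: upt_Suc)
      qed
    qed
    have len: "length (bs i) = (if i < D then i else D)" for i unfolding bs by simp
    have hd: "hd (bs (j + D) @ [\<beta> (j + D)]) = \<beta> j" for j
    proof -
      have "bs (j + D) @ [\<beta> (j + D)] = map \<beta> [j..<Suc (j + D)]" unfolding bs by simp
      then show ?thesis by (simp add: upt_conv_Cons del: upt_Suc)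
    qed
    have "\<exists>c. (\<rho> (j + D), \<alpha> (j + D), Some c, \<rho> (Suc (j + D))) \<in> td_trans T \<and>
        d (Suc (j + D)) = 2 * d (j + D) + of_bool c - of_bool (\<beta> j) \<and>
        d (Suc (j + D)) \<in> {-1..1}" for j
      using late[of "j + D", unfolded hd] len[of "j + D"] not_add_less2 by metis
    then obtain \<gamma> where \<gamma>: "\<And>j. (\<rho> (j + D), \<alpha> (j + D), Some (\<gamma> j), \<rho> (Suc (j + D))) \<in> td_trans T"
        "\<And>j. d (Suc (j + D)) = 2 * d (j + D) + of_bool (\<gamma> j) - of_bool (\<beta> j)"
        "\<And>j. d (Suc (j + D)) \<in> {-1..1}"
      by metis
    have d0: "i \<le> D \<Longrightarrow> d i = 0" for i
    proof (induction i)
      case 0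
      show ?case using init by (simp add: d_def s0_def)
    next
      case (Suc i)
      then show ?case using early(3)[of i] len[of i] by simp
    qed
    \<comment> \<open>The stored difference lags by \<open>D\<close>, since nothing is compared
      during the delay.\<close>
    have diff: "prefix_difference \<gamma> \<beta> j = d (j + D)" for j
      by (induction j) (simp_all add: d0 \<gamma>(2))
    have "prefix_difference \<gamma> \<beta> j \<in> {-1..1}" for j
      by (cases j) (use \<gamma>(3) diff in \<open>auto simp del: prefix_difference.simps(2)\<close>)
    then have "binary_value \<gamma> = binary_value \<beta>" unfolding binary_value_eq_iff by blast
    moreover have "td_run T D \<alpha> \<rho> \<gamma>"
      unfolding td_run_def
    proof (intro conjI allI impI)
      show "\<rho> 0 = td_initial T" using init by (simp add: \<rho>_def s0_def)
      show "(\<rho> i, \<alpha> i, None, \<rho> (Suc i)) \<in> td_trans T" if "i < D" for i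
        using early(1)[of i] len[of i] that by simp
      show "(\<rho> i, \<alpha> i, Some (\<gamma> (i - D)), \<rho> (Suc i)) \<in> td_trans T" if "D \<le> i" for i
        using \<gamma>(1)[of "i - D"] that by simp
    qed
    ultimately show "\<exists>\<rho> \<gamma>. td_run T D \<alpha> \<rho> \<gamma> \<and> binary_value \<gamma> = binary_value \<beta>" by blast
  next
    assume "\<exists>\<rho> \<gamma>. td_run T D \<alpha> \<rho> \<gamma> \<and> binary_value \<gamma> = binary_value \<beta>"
    then obtain \<rho> \<gamma> where run: "td_run T D \<alpha> \<rho> \<gamma>" and eq: "binary_value \<gamma> = binary_value \<beta>" by blast
    have bounded: "prefix_difference \<gamma> \<beta> j \<in> {-1..1}" for j
      using eq unfolding binary_value_eq_iff by blast
    \<comment> \<open>For \<open>i < D\<close> the term \<open>i - D\<close> is 0, which gives a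
      queue of all letters so far and the difference 0.\<close>
    define \<sigma> where "\<sigma> i = (\<rho> i, map \<beta> [i - D..<i], prefix_difference \<gamma> \<beta> (i - D))" for i
    have "(\<sigma> i, \<alpha> i, \<beta> i, \<sigma> (Suc i)) \<in> E" for i
    proof (cases "i < D")
      case True
      then have tr: "(\<rho> i, \<alpha> i, None, \<rho> (Suc i)) \<in> td_trans T"
        using run unfolding td_run_def by blast
      then have "\<rho> i \<in> td_states T" using T unfolding finite_state_transducer_def by blast
      then show ?thesis using True tr unfolding E_def S_def \<sigma>_def by simp
    next
      case False
      then have tr: "(\<rho> i, \<alpha> i, Some (\<gamma> (i - D)), \<rho> (Suc i)) \<in> td_trans T"
        using run unfolding td_run_def by simp
      then have "\<rho> i \<in> td_states T" using T unfolding finite_state_transducer_def by blast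
      then have S: "\<sigma> i \<in> S" using False bounded unfolding S_def \<sigma>_def by auto
      have snoc: "map \<beta> [i - D..<i] @ [\<beta> i] = map \<beta> [i - D..<Suc i]" by simp
      have hd: "hd (map \<beta> [i - D..<i] @ [\<beta> i]) = \<beta> (i - D)"
        unfolding snoc by (simp add: upt_conv_Cons del: upt_Suc)
      have tl: "tl (map \<beta> [i - D..<i] @ [\<beta> i]) = map \<beta> [Suc i - D..<Suc i]"
        unfolding snoc using False by (simp add: Suc_diff_le map_tl[symmetric] del: upt_Suc)
      have pd: "prefix_difference \<gamma> \<beta> (Suc i - D) =
          2 * prefix_difference \<gamma> \<beta> (i - D) + of_bool (\<gamma> (i - D)) - of_bool (\<beta> (i - D))"
        using False by (simp add: Suc_diff_le)
      show ?thesis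
        unfolding E_def
      proof (rule UnI2, rule CollectI, intro exI conjI)
        show "(\<sigma> i, \<alpha> i, \<beta> i, \<sigma> (Suc i)) =
          ((\<rho> i, map \<beta> [i - D..<i], prefix_difference \<gamma> \<beta> (i - D)), \<alpha> i, \<beta> i,
           (\<rho> (Suc i), tl (map \<beta> [i - D..<i] @ [\<beta> i]), prefix_difference \<gamma> \<beta> (Suc i - D)))"
          unfolding \<sigma>_def tl by simp
        show "(\<rho> i, map \<beta> [i - D..<i], prefix_difference \<gamma> \<beta> (i - D)) \<in> S"
          using S unfolding \<sigma>_def .
        show "length (map \<beta> [i - D..<i]) = D" using False by simp
        show "prefix_difference \<gamma> \<beta> (Suc i - D) = 2 * prefix_difference \<gamma> \<beta> (i - D) +
            of_bool (\<gamma> (i - D)) - of_bool (hd (map \<beta> [i - D..<i] @ [\<beta> i]))"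
          unfolding hd by (rule pd)
      qed (use tr bounded in auto)
    qed
    moreover have "\<sigma> 0 = s0" using run by (simp add: \<sigma>_def s0_def td_run_def)
    ultimately show "\<exists>\<sigma>. \<sigma> 0 = s0 \<and> (\<forall>i. (\<sigma> i, \<alpha> i, \<beta> i, \<sigma> (Suc i)) \<in> E)" by blast
  qed
  then show ?thesis
    using safety_relation_recognizable[OF finS s0 E] unfolding regular_function_def by simp
qed

theorem theorem1p1:
  fixes f :: "real \<Rightarrow> real"
  assumes "f \<in> {0..1} \<rightarrow> {0..1}"
  shows "(continuous_on {0..1} f \<and> regular_function f) \<longleftrightarrow> transducer_computable f"
  using transducer_computable_if_continuous_regular[OF assms]
    continuous_if_transducer_computable regular_if_transducer_computable
  by blast

end
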